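(* Let $P_n$ be a path on $n$ vertices. Then $$\mathcal{S}_{\chi^-}(P_n,x)=\begin{cases}\sum\limits_{i=0}^{\frac{n-1}{2}}\left[(3n-6i-3)x+(3n-6i-1)\right]x^{2i}, & \text{if } n \text{ is odd};\\[2mm] 3\sum\limits_{i=0}^{n}(n-i)x^i, & \text{if } n \text{ is even}.\end{cases}$$
   Context: All graphs are finite, simple, undirected and connected; $d(u,v)$ is the usual graph distance. Let $\ell=\chi(G)$ be the chromatic number of $G$. All colourings considered are proper vertex colourings with exactly $\ell$ colours $c_1,\dots,c_\ell$; for such a colouring $\varphi$ put $\zeta_\varphi(v)=s$ if $\varphi(v)=c_s$. A $\chi^-$-colouring of $G$ is such a colouring in which $c_1$ is assigned to the maximum possible number of vertices, then, subject to this, $c_2$ is assigned to the maximum possible number of the remaining vertices, and so on until all vertices are coloured. The $\chi^-$-chromatic Schultz polynomial of $G$ is $$\mathcal{S}_{\chi^-}(G,x)=\sum_{u,v\in V(G)}\bigl(\zeta_{\varphi^-}(u)+\zeta_{\varphi^-}(v)\bigr)x^{d(u,v)},$$ where $\varphi^-$ is a $\chi^-$-colouring of $G$, and the sum runs over unordered pairs $\{u,v\}$ of vertices, each counted once, with the case $u=v$ included (so each vertex $v$ contributes $2\zeta_{\varphi^-}(v)$ to the constant term). *)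

theory Defs
  imports
    "Graph_Theory.Graph_Theory"
    "HOL-Library.Uprod"
    "HOL-Computational_Algebra.Polynomial"
begin

text \<open>
  A finite simple undirected graph is a \<^locale>\<open>pair_graph\<close>: a finite loop-free symmetric digraph
  whose arcs are pairs of vertices, so that an edge \<open>uv\<close> is the pair of arcs \<open>(u, v)\<close>, \<open>(v, u)\<close>.
\<close>

definition graph_dist :: "'a pair_pre_digraph \<Rightarrow> 'a \<Rightarrow> 'a \<Rightarrow> nat" where
  "graph_dist G u v = (LEAST k. \<exists>p. pre_digraph.awalk (with_proj G) u p v \<and> length p = k)"

text \<open>The colour \<open>c\<^sub>s\<close> is represented by its index \<open>s\<close>; hence \<open>\<zeta>\<^sub>\<phi>\<close> is \<open>\<phi>\<close> itself.\<close>

definition proper_colouring :: "'a pair_pre_digraph \<Rightarrow> nat \<Rightarrow> ('a \<Rightarrow> nat) \<Rightarrow> bool" where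
  "proper_colouring G k \<phi> \<longleftrightarrow>
     \<phi> ` pverts G = {1..k} \<and> (\<forall>(u, v) \<in> parcs G. \<phi> u \<noteq> \<phi> v)"

definition chromatic_number :: "'a pair_pre_digraph \<Rightarrow> nat" where
  "chromatic_number G = (LEAST k. \<exists>\<phi>. proper_colouring G k \<phi>)"

definition colour_class :: "'a pair_pre_digraph \<Rightarrow> ('a \<Rightarrow> nat) \<Rightarrow> nat \<Rightarrow> 'a set" where
  "colour_class G \<phi> s = {v \<in> pverts G. \<phi> v = s}"

text \<open>
  For every \<open>s\<close> in turn, the size of the class of \<open>c\<^sub>s\<close> is the largest possible one among the proper
  colourings with \<open>\<chi>(G)\<close> colours whose classes of \<open>c\<^sub>1, \<dots>, c\<^bsub>s-1\<^esub>\<close> have the (already maximal) sizes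
  they have in \<open>\<phi>\<close>.
\<close>

definition chi_minus_colouring :: "'a pair_pre_digraph \<Rightarrow> ('a \<Rightarrow> nat) \<Rightarrow> bool" where
  "chi_minus_colouring G \<phi> \<longleftrightarrow>
     proper_colouring G (chromatic_number G) \<phi> \<and>
     (\<forall>s \<in> {1..chromatic_number G}. \<forall>\<psi>.
        proper_colouring G (chromatic_number G) \<psi> \<longrightarrow>
        (\<forall>t \<in> {1..<s}. card (colour_class G \<psi> t) = card (colour_class G \<phi> t)) \<longrightarrow>
        card (colour_class G \<psi> s) \<le> card (colour_class G \<phi> s))"

text \<open>
  The summand of the Schultz polynomial, as a function of an unordered pair of vertices. Its
  symmetry in \<open>u\<close> and \<open>v\<close>, on which the use of \<^const>\<open>Abs_commute\<close> relies, holds in every graph by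
  \<open>apply_schultz_term\<close> below.
\<close>

definition schultz_term :: "'a pair_pre_digraph \<Rightarrow> ('a \<Rightarrow> nat) \<Rightarrow> ('a, int poly) commute" where
  "schultz_term G \<phi> = Abs_commute (\<lambda>u v. monom (int (\<phi> u + \<phi> v)) (graph_dist G u v))"

text \<open>
  An unordered pair may be \<open>Upair v v\<close>. If \<open>\<phi>\<close> is a \<open>\<chi>\<^sup>-\<close>-colouring, this is the
  \<open>\<chi>\<^sup>-\<close>-chromatic Schultz polynomial.
\<close>

definition schultz_poly :: "'a pair_pre_digraph \<Rightarrow> ('a \<Rightarrow> nat) \<Rightarrow> int poly" where
  "schultz_poly G \<phi> =
     (\<Sum>e \<in> {e. set_uprod e \<subseteq> pverts G}. case_uprod (schultz_term G \<phi>) e)"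

definition path_graph :: "'a pair_pre_digraph \<Rightarrow> nat \<Rightarrow> bool" where
  "path_graph G n \<longleftrightarrow>
     (\<exists>v. bij_betw v {1..n} (pverts G) \<and>
          parcs G = (\<Union>i \<in> {1..<n}. {(v i, v (Suc i)), (v (Suc i), v i)}))"


lemma ereal_graph_dist:
  assumes "pair_graph G" and "u \<rightarrow>\<^sup>*\<^bsub>with_proj G\<^esub> v"
  shows "ereal (real (graph_dist G u v)) = wf_digraph.\<mu> (with_proj G) (\<lambda>_. 1) u v"
proof -
  interpret pair_graph G by fact
  let ?P = "\<lambda>k. \<exists>p. awalk u p v \<and> length p = k"
  have cost: "awalk_cost (\<lambda>_. 1) p = real (length p)" for p :: "('a \<times> 'a) list"
    by (induction p) auto
  have "\<exists>k. ?P k"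
    using assms(2) by (auto simp: reachable_awalk)
  then have "?P (graph_dist G u v)"
    unfolding graph_dist_def by (rule LeastI_ex)
  then obtain p where p: "awalk u p v" "length p = graph_dist G u v"
    by blast
  have least: "graph_dist G u v \<le> length q" if "awalk u q v" for q
    unfolding graph_dist_def using that by (intro Least_le) blast
  show ?thesis
  proof (rule antisym)
    show "ereal (real (graph_dist G u v)) \<le> \<mu> (\<lambda>_. 1) u v"
      unfolding \<mu>_def cost using least by (auto intro!: INF_greatest)
    show "\<mu> (\<lambda>_. 1) u v \<le> ereal (real (graph_dist G u v))"
      using min_cost_le_walk_cost[OF p(1), of "\<lambda>_. 1"] p(2) by (simp add: cost)
  qed
qed

lemma length_rev_path: "length (rev_path p) = length p"
  by (induction p) auto

lemma graph_dist_commute: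
  assumes "pair_graph G"
  shows "graph_dist G u v = graph_dist G v u"
proof -
  interpret pair_graph G by fact
  have "(\<exists>p. awalk u p v \<and> length p = k) \<longleftrightarrow> (\<exists>p. awalk v p u \<and> length p = k)" for k
    using awalk_rev_path length_rev_path by metis
  then show ?thesis
    unfolding graph_dist_def by simp
qed

lemma apply_schultz_term:
  assumes "pair_graph G"
  shows "apply_commute (schultz_term G \<phi>) u v = monom (int (\<phi> u + \<phi> v)) (graph_dist G u v)"
  unfolding schultz_term_def
  using graph_dist_commute[OF assms] by (subst Abs_commute_inverse) (auto simp: add.commute)

lemma path_graph_pair_graph:
  assumes "path_graph G n"
  shows "pair_graph G"
proof -
  from assms obtain v where v: "bij_betw v {1..n} (pverts G)"
    and arcs: "parcs G = (\<Union>i \<in> {1..<n}. {(v i, v (Suc i)), (v (Suc i), v i)})"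
    by (auto simp: path_graph_def)
  have V: "v i \<in> pverts G" if "1 \<le> i" "i \<le> n" for i
    using v that by (auto simp: bij_betw_def)
  have inj: "v i \<noteq> v (Suc i)" if "1 \<le> i" "i < n" for i
    using v that inj_onD[of v "{1..n}" i "Suc i"] by (auto simp: bij_betw_def)
  show ?thesis
  proof
    show "finite (pverts G)" using v bij_betw_finite by blast
    show "finite (parcs G)" by (simp add: arcs)
    show "fst e \<in> pverts G" if "e \<in> parcs G" for e using that V by (auto simp: arcs)
    show "snd e \<in> pverts G" if "e \<in> parcs G" for e using that V by (auto simp: arcs)
    show "fst e \<noteq> snd e" if "e \<in> parcs G" for e
      using that inj inj[symmetric] by (auto simp: arcs)
    show "symmetric (with_proj G)"
      by (auto simp: symmetric_def sym_def arcs)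
  qed
qed

lemma proper_colouring_chromatic_number:
  assumes "pair_graph G"
  shows "\<exists>\<phi>. proper_colouring G (chromatic_number G) \<phi>"
proof -
  interpret pair_graph G by fact
  obtain f where f: "bij_betw f (pverts G) {1..card (pverts G)}"
    using finite_same_card_bij[of "pverts G" "{1..card (pverts G)}"] pair_finite_verts by auto
  have "f u \<noteq> f v" if "(u, v) \<in> parcs G" for u v
    using f no_loops'[OF that] in_arcsD1[OF that] in_arcsD2[OF that]
    by (auto simp: bij_betw_def dest: inj_onD)
  then have "proper_colouring G (card (pverts G)) f"
    using f by (auto simp: proper_colouring_def bij_betw_def)
  then have "\<exists>k \<phi>. proper_colouring G k \<phi>"
    by blast
  then show ?thesis
    unfolding chromatic_number_def by (rule LeastI_ex)
qed

lemma chi_minus_colouring_exists: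
  assumes "pair_graph G"
  shows "\<exists>\<phi>. chi_minus_colouring G \<phi>"
proof -
  interpret pair_graph G by fact
  define P where "P = proper_colouring G (chromatic_number G)"
  define c where "c = (\<lambda>\<phi> s. card (colour_class G \<phi> s))"
  have bound: "c \<phi> s < Suc (card (pverts G))" for \<phi> s
    unfolding c_def colour_class_def using pair_finite_verts
    by (auto intro!: card_mono simp: less_Suc_eq_le)
  have "\<exists>\<phi>. P \<phi> \<and> (\<forall>s \<in> {1..m}. \<forall>\<psi>. P \<psi> \<longrightarrow> (\<forall>t \<in> {1..<s}. c \<psi> t = c \<phi> t) \<longrightarrow> c \<psi> s \<le> c \<phi> s)" for m
  proof (induction m)
    case 0
    then show ?case
      using proper_colouring_chromatic_number[OF assms] by (auto simp: P_def)
  next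
    case (Suc m)
    then obtain \<phi> where \<phi>: "P \<phi>"
      "\<And>s \<psi>. s \<in> {1..m} \<Longrightarrow> P \<psi> \<Longrightarrow> (\<forall>t \<in> {1..<s}. c \<psi> t = c \<phi> t) \<Longrightarrow> c \<psi> s \<le> c \<phi> s"
      by blast
    let ?Q = "\<lambda>\<psi>. P \<psi> \<and> (\<forall>t \<in> {1..m}. c \<psi> t = c \<phi> t)"
    obtain \<psi> where \<psi>: "?Q \<psi>" "\<And>\<psi>'. ?Q \<psi>' \<Longrightarrow> c \<psi>' (Suc m) \<le> c \<psi> (Suc m)"
      using ex_has_greatest_nat[of ?Q \<phi> "\<lambda>\<psi>. c \<psi> (Suc m)" "Suc (card (pverts G))"] \<phi>(1) bound
      by (auto simp: less_imp_le)
    have "c \<psi>' s \<le> c \<psi> s"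
      if "s \<in> {1..Suc m}" "P \<psi>'" "\<forall>t \<in> {1..<s}. c \<psi>' t = c \<psi> t" for s \<psi>'
    proof (cases "s = Suc m")
      case True
      then show ?thesis using \<psi> that by (auto simp: less_Suc_eq_le)
    next
      case False
      then have s: "s \<in> {1..m}" using that(1) by auto
      have "\<forall>t \<in> {1..<s}. c \<psi>' t = c \<phi> t" using that(3) \<psi>(1) s by auto
      then show ?thesis using \<phi>(2)[OF s that(2)] \<psi>(1) s by auto
    qed
    then show ?case using \<psi>(1) by blast
  qed
  from this[of "chromatic_number G"] show ?thesis
    by (auto simp: chi_minus_colouring_def P_def c_def)
qed

end

theory Submission
  imports Defs
begin

text \<open>
  The distance between the vertices number \<open>i\<close> and \<open>j\<close> of the path is \<open>\<bar>i - j\<bar>\<close>, and a proper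
  colouring with at most two colours alternates along the path. Hence the coefficient of \<open>x\<^sup>d\<close> is
  \<open>3 (n - d)\<close> if \<open>d\<close> is odd, each of the \<open>n - d\<close> pairs contributing \<open>1 + 2\<close>, and twice the sum of
  the first \<open>n - d\<close> colours if \<open>d\<close> is even. The latter depends on which colour comes first only if
  \<open>n\<close> is odd, and then maximality of the class of \<open>c\<^sub>1\<close> forces the end vertices to have colour \<open>c\<^sub>1\<close>.
\<close>

section \<open>Distances in a path\<close>

text \<open>Each arc of a walk changes \<open>f\<close> by at most 1, so the triangle inequality
  bounds the total change by the number of arcs. This serves as the lower bound for
  distances.\<close>

lemma awalk_lipschitz:
  fixes f :: "'a \<Rightarrow> int"
  assumes "pair_graph G" and "\<And>u w. (u, w) \<in> parcs G \<Longrightarrow> \<bar>f u - f w\<bar> \<le> 1"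
    and "pre_digraph.awalk (with_proj G) u p w"
  shows "\<bar>f u - f w\<bar> \<le> int (length p)"
proof -
  interpret pair_graph G by fact
  show ?thesis
    using assms(3)
  proof (induction p arbitrary: u)
    case Nil
    then show ?case by (simp add: awalk_Nil_iff)
  next
    case (Cons e p)
    obtain x y where e: "e = (x, y)" by fastforce
    with Cons.prems have "(x, y) \<in> parcs G" "u = x" "awalk y p w"
      by (auto simp: awalk_Cons_iff)
    then show ?case
      using Cons.IH[of y] assms(2)[of x y] by simp
  qed
qed

lemma path_graph_dist:
  assumes "path_graph G n" and v: "bij_betw v {1..n} (pverts G)"
    and arcs: "parcs G = (\<Union>i \<in> {1..<n}. {(v i, v (Suc i)), (v (Suc i), v i)})"
    and "1 \<le> i" and "i + d \<le> n"
  shows "graph_dist G (v i) (v (i + d)) = d"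
proof -
  interpret pair_graph G using assms(1) by (rule path_graph_pair_graph)
  have V: "v j \<in> pverts G" if "1 \<le> j" "j \<le> n" for j
    using v that by (auto simp: bij_betw_def)
  have walk: "\<exists>p. awalk (v i) p (v (i + d)) \<and> length p = d"
    using assms(4,5)
  proof (induction d arbitrary: i)
    case 0
    then show ?case using V by (auto simp: awalk_Nil_iff)
  next
    case (Suc d)
    then obtain p where "awalk (v (Suc i)) p (v (Suc i + d))" "length p = d"
      by fastforce
    moreover have "(v i, v (Suc i)) \<in> parcs G" using Suc.prems by (auto simp: arcs)
    ultimately show ?case
      by (intro exI[of _ "(v i, v (Suc i)) # p"]) (simp add: awalk_Cons_iff)
  qed
  \<comment> \<open>The walk above gives the upper bound. For the lower bound, the position along
    the path is a function that changes by exactly 1 on each arc.\<close>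
  define f where "f = (\<lambda>x. int (inv_into {1..n} v x))"
  have f: "f (v j) = int j" if "1 \<le> j" "j \<le> n" for j
    using v that by (auto simp: f_def bij_betw_def)
  have lip: "\<bar>f x - f y\<bar> \<le> 1" if "(x, y) \<in> parcs G" for x y
    using that by (auto simp: arcs f)
  have "d \<le> length p" if "awalk (v i) p (v (i + d))" for p
    using awalk_lipschitz[of G f, OF pair_graph_axioms lip that] assms(4,5) by (simp add: f)
  with walk show ?thesis
    unfolding graph_dist_def by (intro Least_equality) blast+
qed

section \<open>Sums over unordered pairs of vertices\<close>

text \<open>An unordered pair is determined by its smaller index \<open>i\<close> and the gap
  \<open>d\<close> between its indices; \<open>d = 0\<close> gives the pairs
  \<open>Upair x x\<close>. On a path the gap is the distance, so the inner sum collects one power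
  of the variable.\<close>

lemma sum_uprod_bij_betw:
  fixes v :: "nat \<Rightarrow> 'a"
  assumes "bij_betw v {1..n} A"
  shows "(\<Sum>e \<in> {e. set_uprod e \<subseteq> A}. g e) = (\<Sum>d<n. \<Sum>i = 1..n - d. g (Upair (v i) (v (i + d))))"
proof -
  let ?I = "SIGMA d:{..<n}. {1..n - d}"
  let ?h = "\<lambda>(d, i). Upair (v i) (v (i + d))"
  have inj: "v i = v j \<longleftrightarrow> i = j" if "i \<in> {1..n}" "j \<in> {1..n}" for i j
    using inj_on_eq_iff[OF bij_betw_imp_inj_on[OF assms] that] .
  have A: "A = v ` {1..n}" by (rule bij_betw_imp_surj_on[OF assms, symmetric])
  have "inj_on ?h ?I"
  proof (rule inj_onI)
    fix p q assume pq: "p \<in> ?I" "q \<in> ?I" "?h p = ?h q"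
    obtain d i e j where [simp]: "p = (d, i)" "q = (e, j)" by (cases p, cases q)
    have "i \<in> {1..n}" "i + d \<in> {1..n}" "j \<in> {1..n}" "j + e \<in> {1..n}"
      using pq(1,2) by auto
    \<comment> \<open>In the second alternative \<open>d + e = 0\<close>, so both alternatives give
      \<open>p = q\<close>.\<close>
    with pq(3) have "i = j \<and> i + d = j + e \<or> i = j + e \<and> i + d = j"
      by (simp add: inj)
    then show "p = q" by auto
  qed
  moreover have "?h ` ?I = {e. set_uprod e \<subseteq> A}"
  proof (intro equalityI subsetI)
    fix e assume "e \<in> ?h ` ?I"
    then show "e \<in> {e. set_uprod e \<subseteq> A}" by (auto simp: A)
  next
    fix e assume e: "e \<in> {e. set_uprod e \<subseteq> A}"
    obtain x y where xy: "e = Upair x y" by (cases e) auto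
    with e have "x \<in> A" "y \<in> A" by auto
    then obtain i j where ij: "e = Upair (v i) (v j)" "i \<in> {1..n}" "j \<in> {1..n}"
      unfolding A xy by blast
    show "e \<in> ?h ` ?I"
    proof (cases "i \<le> j")
      case True
      then show ?thesis using ij by (intro image_eqI[of _ _ "(j - i, i)"]) auto
    next
      case False
      then show ?thesis using ij by (intro image_eqI[of _ _ "(i - j, j)"]) auto
    qed
  qed
  ultimately have "bij_betw ?h ?I {e. set_uprod e \<subseteq> A}"
    by (simp add: bij_betw_def)
  then have "(\<Sum>e \<in> {e. set_uprod e \<subseteq> A}. g e) = (\<Sum>p \<in> ?I. g (?h p))"
    by (simp add: sum.reindex_bij_betw)
  also have "\<dots> = (\<Sum>d<n. \<Sum>i = 1..n - d. g (Upair (v i) (v (i + d))))"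
    by (subst sum.Sigma) (auto simp: case_prod_unfold)
  finally show ?thesis .
qed

lemma schultz_poly_path:
  assumes "path_graph G n" and v: "bij_betw v {1..n} (pverts G)"
    and "parcs G = (\<Union>i \<in> {1..<n}. {(v i, v (Suc i)), (v (Suc i), v i)})"
  shows "schultz_poly G \<phi> = (\<Sum>d<n. monom (\<Sum>i = 1..n - d. int (\<phi> (v i) + \<phi> (v (i + d)))) d)"
proof -
  have term_eq: "case_uprod (schultz_term G \<phi>) (Upair (v i) (v (i + d)))
      = monom (int (\<phi> (v i) + \<phi> (v (i + d)))) d" if "i \<in> {1..n - d}" "d < n" for i d
  proof -
    have "graph_dist G (v i) (v (i + d)) = d"
      using that by (intro path_graph_dist[OF assms]) auto
    then show ?thesis
      by (simp add: apply_schultz_term[OF path_graph_pair_graph[OF assms(1)]])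
  qed
  have "schultz_poly G \<phi> = (\<Sum>d<n. \<Sum>i = 1..n - d. monom (int (\<phi> (v i) + \<phi> (v (i + d)))) d)"
    unfolding schultz_poly_def sum_uprod_bij_betw[OF v] by (intro sum.cong refl term_eq) auto
  then show ?thesis
    by (simp add: monom_sum)
qed

section \<open>Two-colourings of a path\<close>

text \<open>Adjacent vertices receive different colours from {1, 2}, and \<open>3 - c\<close> is the
  colour other than \<open>c\<close>.\<close>

lemma proper_colouring_path_alternating:
  assumes v: "bij_betw v {1..n} (pverts G)"
    and arcs: "parcs G = (\<Union>i \<in> {1..<n}. {(v i, v (Suc i)), (v (Suc i), v i)})"
    and "proper_colouring G 2 \<phi>" and "i \<in> {1..n}"
  shows "\<phi> (v i) = (if odd i then \<phi> (v 1) else 3 - \<phi> (v 1))"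
proof -
  have col: "\<phi> (v j) \<in> {1, 2}" if "1 \<le> j" "j \<le> n" for j
  proof -
    have "v j \<in> pverts G" using v that by (auto simp: bij_betw_def)
    then have "\<phi> (v j) \<in> {1..2}" using assms(3) by (auto simp: proper_colouring_def)
    then show ?thesis by auto
  qed
  have "1 \<le> i" "i \<le> n" using assms(4) by auto
  then show ?thesis
  proof (induction i rule: dec_induct)
    case base
    then show ?case by simp
  next
    case (step i)
    then have "(v i, v (Suc i)) \<in> parcs G" by (auto simp: arcs)
    then have "\<phi> (v i) \<noteq> \<phi> (v (Suc i))" using assms(3) by (auto simp: proper_colouring_def)
    moreover have "\<phi> (v 1) \<in> {1, 2}" "\<phi> (v (Suc i)) \<in> {1, 2}"
      using col[of 1] col[of "Suc i"] step by auto
    ultimately show ?case using step by (auto split: if_splits)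
  qed
qed

text \<open>This colouring bounds the chromatic number from above and later competes against a
  colouring that starts with colour 2.\<close>

lemma path_proper_colouring:
  assumes v: "bij_betw v {1..n} (pverts G)"
    and arcs: "parcs G = (\<Union>i \<in> {1..<n}. {(v i, v (Suc i)), (v (Suc i), v i)})" and "n \<ge> 2"
  obtains \<psi> where "proper_colouring G 2 \<psi>" and "\<psi> (v 1) = 1"
proof -
  define \<psi> :: "'a \<Rightarrow> nat" where "\<psi> = (\<lambda>x. if odd (inv_into {1..n} v x) then 1 else 2)"
  have \<psi>: "\<psi> (v i) = (if odd i then 1 else 2)" if "1 \<le> i" "i \<le> n" for i
    using v that by (auto simp: \<psi>_def bij_betw_def)
  have "v 1 \<in> pverts G" "v 2 \<in> pverts G" using bij_betwE[OF v] assms(3) by auto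
  moreover have v12: "\<psi> (v 1) = 1" "\<psi> (v 2) = 2" using \<psi>[of 1] \<psi>[of 2] assms(3) by simp_all
  ultimately have "1 \<in> \<psi> ` pverts G" "2 \<in> \<psi> ` pverts G" by (metis imageI)+
  moreover have "\<psi> x \<in> {1, 2}" for x by (simp add: \<psi>_def)
  ultimately have "\<psi> ` pverts G = {1, 2}" by blast
  moreover have "{1..2} = {1, 2 :: nat}" by auto
  moreover have "\<forall>(x, y) \<in> parcs G. \<psi> x \<noteq> \<psi> y"
    unfolding arcs using \<psi> by auto
  ultimately have "proper_colouring G 2 \<psi>"
    by (simp add: proper_colouring_def)
  then show ?thesis
    using that v12(1) by blast
qed

lemma chromatic_number_path:
  assumes "path_graph G n" and "n \<ge> 2"
  shows "chromatic_number G = 2"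
proof -
  obtain v where v: "bij_betw v {1..n} (pverts G)"
    and arcs: "parcs G = (\<Union>i \<in> {1..<n}. {(v i, v (Suc i)), (v (Suc i), v i)})"
    using assms(1) by (auto simp: path_graph_def)
  have "2 \<le> k" if "proper_colouring G k \<phi>" for k \<phi>
  proof -
    have "v 1 \<in> pverts G" "v 2 \<in> pverts G" using bij_betwE[OF v] assms(2) by auto
    then have "\<phi> (v 1) \<in> {1..k}" "\<phi> (v 2) \<in> {1..k}"
      using that by (auto simp: proper_colouring_def)
    moreover have "(v 1, v 2) \<in> parcs G"
      unfolding arcs using assms(2) by (auto intro!: bexI[of _ 1] simp: numeral_2_eq_2)
    then have "\<phi> (v 1) \<noteq> \<phi> (v 2)" using that by (auto simp: proper_colouring_def)
    ultimately show ?thesis by auto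
  qed
  moreover obtain \<psi> where "proper_colouring G 2 \<psi>"
    using path_proper_colouring[OF v arcs assms(2)] .
  ultimately show ?thesis
    unfolding chromatic_number_def by (intro Least_equality) blast+
qed

section \<open>The largest first colour class\<close>

lemma card_odd_even:
  "card {i \<in> {1..n}. odd i} = (n + 1) div 2" "card {i \<in> {1..n}. even i} = n div 2"
proof -
  have 1: "{i \<in> {1..Suc n}. odd i} =
      (if even n then insert (Suc n) {i \<in> {1..n}. odd i} else {i \<in> {1..n}. odd i})"
    and 2: "{i \<in> {1..Suc n}. even i} =
      (if odd n then insert (Suc n) {i \<in> {1..n}. even i} else {i \<in> {1..n}. even i})" for n
    by (auto simp: le_Suc_eq)
  show "card {i \<in> {1..n}. odd i} = (n + 1) div 2" "card {i \<in> {1..n}. even i} = n div 2"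
    by (induction n) (simp_all only: 1 2, auto)
qed

lemma chi_minus_colouring_path_start:
  assumes "path_graph G n" and v: "bij_betw v {1..n} (pverts G)"
    and arcs: "parcs G = (\<Union>i \<in> {1..<n}. {(v i, v (Suc i)), (v (Suc i), v i)})"
    and "n \<ge> 2" and "odd n" and "chi_minus_colouring G \<phi>"
  shows "\<phi> (v 1) = 1"
proof (rule ccontr)
  assume *: "\<phi> (v 1) \<noteq> 1"
  have \<chi>: "chromatic_number G = 2" using chromatic_number_path assms(1,4) by blast
  \<comment> \<open>This is maximality for \<open>s = 1\<close>: there are no earlier classes to
    agree on, so every proper 2-colouring is a competitor.\<close>
  then have \<phi>: "proper_colouring G 2 \<phi>"
    and max: "\<And>\<psi>. proper_colouring G 2 \<psi> \<Longrightarrow>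
      card (colour_class G \<psi> 1) \<le> card (colour_class G \<phi> 1)"
    using assms(6) by (auto simp: chi_minus_colouring_def)
  obtain \<psi> where \<psi>: "proper_colouring G 2 \<psi>" "\<psi> (v 1) = 1"
    using path_proper_colouring[OF assms(2-4)] .
  have "v 1 \<in> pverts G" using bij_betwE[OF v] assms(4) by auto
  then have "\<phi> (v 1) \<in> {1..2}" using \<phi> by (auto simp: proper_colouring_def)
  with * have two: "\<phi> (v 1) = 2" by auto
  have card_class: "card (colour_class G \<chi> 1) = card {i \<in> {1..n}. \<chi> (v i) = 1}" for \<chi>
  proof -
    have "colour_class G \<chi> 1 = v ` {i \<in> {1..n}. \<chi> (v i) = 1}"
      unfolding colour_class_def bij_betw_imp_surj_on[OF v, symmetric] by blast
    moreover have "inj_on v {i \<in> {1..n}. \<chi> (v i) = 1}"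
      using v by (auto simp: bij_betw_def intro: inj_on_subset)
    ultimately show ?thesis by (simp add: card_image)
  qed
  have "{i \<in> {1..n}. \<psi> (v i) = 1} = {i \<in> {1..n}. odd i}"
    using proper_colouring_path_alternating[OF v arcs \<psi>(1), unfolded \<psi>(2)] by auto
  moreover have "{i \<in> {1..n}. \<phi> (v i) = 1} = {i \<in> {1..n}. even i}"
    using proper_colouring_path_alternating[OF v arcs \<phi>, unfolded two] by (auto split: if_splits)
  ultimately have "(n + 1) div 2 \<le> n div 2"
    using max[OF \<psi>(1)] by (simp only: card_class card_odd_even)
  with \<open>odd n\<close> show False by (auto elim: oddE)
qed

section \<open>The coefficients\<close>

text \<open>Two consecutive terms add up to 3; for odd \<open>m\<close> a single \<open>c\<close> is
  left over, and twice it differs from 3 by \<open>2 * c - 3\<close>. The factor 2 avoids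
  halves.\<close>

lemma sum_alternating:
  fixes c :: int
  shows "2 * (\<Sum>i = 1..m. if odd i then c else 3 - c) = 3 * int m + (if odd m then 2 * c - 3 else 0)"
  by (induction m) (auto simp: algebra_simps)

lemma schultz_coeff_alternating:
  fixes a :: "nat \<Rightarrow> nat"
  assumes a: "\<And>i. i \<in> {1..n} \<Longrightarrow> a i = (if odd i then c else 3 - c)"
    and c: "c \<in> {1, 2}" and odd: "odd n \<Longrightarrow> c = 1" and "d < n"
  shows "(\<Sum>i = 1..n - d. int (a i + a (i + d))) =
    3 * (int n - int d) - (if odd n \<and> even d then 1 else 0)"
proof -
  have "(\<Sum>i = 1..n - d. int (a i + a (i + d))) =
      (\<Sum>i = 1..n - d. if odd d then 3 else 2 * (if odd i then int c else 3 - int c))"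
    using a c by (intro sum.cong refl) auto
  also have "\<dots> = 3 * (int n - int d) - (if odd n \<and> even d then 1 else 0)"
  proof (cases "odd d")
    case True
    then show ?thesis using \<open>d < n\<close> by (simp add: of_nat_diff)
  next
    case False
    then have "(\<Sum>i = 1..n - d. if odd d then 3 else 2 * (if odd i then int c else 3 - int c)) =
        2 * (\<Sum>i = 1..n - d. if odd i then int c else 3 - int c)"
      by (simp only: sum_distrib_left if_False)
    also have "\<dots> = 3 * int (n - d) + (if odd (n - d) then 2 * int c - 3 else 0)"
      by (rule sum_alternating)
    \<comment> \<open>For even \<open>d\<close>, \<open>n - d\<close> has the parity of
      \<open>n\<close>. If it is odd, then \<open>c = 1\<close> and the correction
      \<open>2 * c - 3\<close> is -1.\<close>
    finally show ?thesis
      using False \<open>d < n\<close> odd by (auto simp: of_nat_diff)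
  qed
  finally show ?thesis .
qed

text \<open>The closed form for odd \<open>n\<close> joins the coefficients of exponents
  \<open>2 * i\<close> and \<open>2 * i + 1\<close> in one linear factor.\<close>

lemma sum_even_odd_split:
  fixes f :: "nat \<Rightarrow> 'b::comm_monoid_add"
  shows "(\<Sum>d<2 * m. f d) = (\<Sum>i<m. f (2 * i) + f (2 * i + 1))"
  by (induction m) (auto simp: add.assoc)

section \<open>The closed forms for odd and even order\<close>

theorem theorem2p3:
  fixes G :: "'a pair_pre_digraph" and n :: nat and \<phi> :: "'a \<Rightarrow> nat"
  assumes "n \<ge> 1" and "path_graph G n" and "chi_minus_colouring G \<phi>"
  shows "schultz_poly G \<phi> =
    (if odd n
     then \<Sum>i = 0..(n - 1) div 2.
            [:3 * int n - 6 * int i - 1, 3 * int n - 6 * int i - 3:] * monom 1 (2 * i)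
     else 3 * (\<Sum>i = 0..n. monom (int n - int i) i))"
proof -
  obtain v where v: "bij_betw v {1..n} (pverts G)"
    and arcs: "parcs G = (\<Union>i \<in> {1..<n}. {(v i, v (Suc i)), (v (Suc i), v i)})"
    using assms(2) by (auto simp: path_graph_def)
  have "v 1 \<in> pverts G" using bij_betwE[OF v] assms(1) by auto
  have proper: "proper_colouring G (chromatic_number G) \<phi>"
    using assms(3) by (simp add: chi_minus_colouring_def)
  have "(\<forall>i \<in> {1..n}. \<phi> (v i) = (if odd i then \<phi> (v 1) else 3 - \<phi> (v 1))) \<and>
      \<phi> (v 1) \<in> {1, 2} \<and> (odd n \<longrightarrow> \<phi> (v 1) = 1)"
  proof (cases "n = 1")
    \<comment> \<open>A single vertex has chromatic number 1, so the lemmas on 2-colourings do not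
      apply. The one colour used fills an interval starting at 1, hence it is 1.\<close>
    case True
    then have "pverts G = {v 1}" using v by (auto simp: bij_betw_def)
    then have "{\<phi> (v 1)} = {1..chromatic_number G}"
      using proper by (simp add: proper_colouring_def)
    moreover from this have "1 \<in> {1..chromatic_number G}"
      by (metis atLeastAtMost_iff insertI1 le_refl le_trans)
    ultimately have "\<phi> (v 1) = 1" by (metis singletonD)
    with True show ?thesis by auto
  next
    case False
    then have n: "n \<ge> 2" using assms(1) by simp
    with proper have \<phi>: "proper_colouring G 2 \<phi>"
      using chromatic_number_path[OF assms(2)] by simp
    then have "\<phi> (v 1) \<in> {1..2}"
      using \<open>v 1 \<in> pverts G\<close> by (auto simp: proper_colouring_def)
    then have "\<phi> (v 1) \<in> {1, 2}" by auto
    then show ?thesis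
      using proper_colouring_path_alternating[OF v arcs \<phi>]
        chi_minus_colouring_path_start[OF assms(2) v arcs n _ assms(3)] by blast
  qed
  then have coeff: "(\<Sum>i = 1..n - d. int (\<phi> (v i) + \<phi> (v (i + d)))) =
      3 * (int n - int d) - (if odd n \<and> even d then 1 else 0)" if "d < n" for d
    using schultz_coeff_alternating[of n "\<lambda>i. \<phi> (v i)" "\<phi> (v 1)" d] that by blast
  have S: "schultz_poly G \<phi> =
      (\<Sum>d<n. monom (3 * (int n - int d) - (if odd n \<and> even d then 1 else 0)) d)"
    unfolding schultz_poly_path[OF assms(2) v arcs]
    by (intro sum.cong refl) (simp only: coeff lessThan_iff)
  show ?thesis
  proof (cases "odd n")
    case True
    then obtain m where n: "n = 2 * m + 1" by (auto elim: oddE)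
    \<comment> \<open>The range is extended by \<open>d = n\<close> to complete the last pair of
      exponents. The new term is 0: \<open>n - d\<close> vanishes, and \<open>d = n\<close> is odd,
      so nothing is subtracted.\<close>
    have "schultz_poly G \<phi> =
        (\<Sum>d<2 * Suc m. monom (3 * (int n - int d) - (if even d then 1 else 0)) d)"
      using True by (simp add: S n)
    also have "\<dots> = (\<Sum>i<Suc m.
        [:3 * int n - 6 * int i - 1, 3 * int n - 6 * int i - 3:] * monom 1 (2 * i))"
      \<comment> \<open>The entries of the linear factor are \<open>3 * (n - 2 * i) - 1\<close> and
        \<open>3 * (n - (2 * i + 1))\<close>; multiplying by the monomial shifts them to exponents
        \<open>2 * i\<close> and \<open>2 * i + 1\<close>.\<close>
      unfolding sum_even_odd_split
      by (intro sum.cong refl poly_eqI)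
        (auto simp: coeff_monom_mult mult.commute[of _ "monom _ _"] coeff_pCons split: nat.splits)
    finally show ?thesis
      using True by (simp add: n atLeast0AtMost lessThan_Suc_atMost)
  next
    case False
    \<comment> \<open>Here too the added term \<open>d = n\<close> is 0.\<close>
    then have "schultz_poly G \<phi> = (\<Sum>d\<in>{0..n}. monom (3 * (int n - int d)) d)"
      by (simp add: S atLeast0AtMost flip: lessThan_Suc_atMost)
    also have "\<dots> = 3 * (\<Sum>i = 0..n. monom (int n - int i) i)"
      unfolding sum_distrib_left by (intro sum.cong refl poly_eqI) (simp add: numeral_poly)
    finally show ?thesis using False by simp
  qed
qed

end
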